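(* Let $A=\{A_i\}_{1\le i\le n+1}$ ($n\ge3$) be a polygon in $\mathbb{R}^N$, let $K_A=\bigcup_{i=1}^n[A_i,A_{i+1}]$, and for $1\le i\le n$ let $$\mathbf{H}_i=\frac{A_i-A_{i-1}}{|A_i-A_{i-1}|}+\frac{A_i-A_{i+1}}{|A_i-A_{i+1}|}$$ (indices modulo $n$). Let $\lambda_1^A$ be the first eigenvalue of the polygon $A$. Then $$\mathcal{H}^1(K_A)\,\lambda_1^A\le\sum_{i=1}^n|\mathbf{H}_i|^2.$$
   Context: For $n\ge3$, a polygon $A=\{A_i\}_{1\le i\le n+1}$ with vertices $A_i\in\mathbb{R}^N$ means: $A_{n+1}=A_1$ (and $A_0:=A_n$), the open segment $]A_i,A_{i+1}[$ does not intersect any other segment $]A_j,A_{j+1}[$, and each vertex $A_i$ belongs to the two consecutive segments $[A_{i-1},A_i]$ and $[A_i,A_{i+1}]$ and to no other one. The first eigenvalue is $$\lambda_1^A:=\inf\left\{\frac{\int_{K_A}|\nabla_P u|^2\,d\mathcal{H}^1}{\sum_{i=1}^n u(A_i)^2}\;:\;u\in C^\infty(\mathbb{R}^N),\ \sum_{i=1}^n u(A_i)^2\ne0,\ \sum_{i=1}^n u(A_i)=0\right\},$$ where $\nabla_P u$ is the tangential gradient of $u$ along $K_A$, i.e. the orthogonal projection of $\nabla u$ onto the line spanned by $A_{i+1}-A_i$ on the segment $[A_i,A_{i+1}]$. *)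

theory Defs
  imports "HOL-Analysis.Analysis"
begin

section \<open>One-dimensional Hausdorff measure\<close>

text \<open>The requirement \<open>bounded\<close> is needed because \<^const>\<open>diameter\<close> is unspecified on unbounded sets.
  The normalising constant of the Hausdorff measure is 1 in dimension one.\<close>

definition hausdorff1_content :: "real \<Rightarrow> 'a::metric_space set \<Rightarrow> ennreal" where
  "hausdorff1_content \<delta> S =
     (INF C\<in>{C :: nat \<Rightarrow> 'a set. S \<subseteq> (\<Union>i. C i) \<and> (\<forall>i. bounded (C i) \<and> diameter (C i) \<le> \<delta>)}.
        \<Sum>i. ennreal (diameter (C i)))"

definition hausdorff1_outer :: "'a::metric_space set \<Rightarrow> ennreal" where
  "hausdorff1_outer S = (SUP \<delta>\<in>{0<..}. hausdorff1_content \<delta> S)"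

text \<open>The set function \<^const>\<open>hausdorff1_outer\<close> is a metric outer measure, hence (Caratheodory) countably
  additive on the Borel sets; so \<^const>\<open>measure_of\<close> does not fall back to the zero measure here.\<close>

definition hausdorff1 :: "'a::metric_space measure" where
  "hausdorff1 = measure_of UNIV (sets borel) hausdorff1_outer"


section \<open>Smooth functions, gradients and projections\<close>

primrec Ck_function :: "nat \<Rightarrow> ('a::real_normed_vector \<Rightarrow> real) \<Rightarrow> bool" where
  "Ck_function 0 f \<longleftrightarrow> continuous_on UNIV f"
| "Ck_function (Suc k) f \<longleftrightarrow>
     (\<forall>x. f differentiable (at x)) \<and> (\<forall>v. Ck_function k (\<lambda>x. frechet_derivative f (at x) v))"

definition smooth_function :: "('a::real_normed_vector \<Rightarrow> real) \<Rightarrow> bool" where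
  "smooth_function f \<longleftrightarrow> (\<forall>k. Ck_function k f)"

definition gradient :: "('a::real_inner \<Rightarrow> real) \<Rightarrow> 'a \<Rightarrow> 'a" where
  "gradient u x = (THE D. GDERIV u x :> D)"

definition orth_proj_line :: "'a::real_inner \<Rightarrow> 'a \<Rightarrow> 'a" where
  "orth_proj_line v g = (THE p. p \<in> span {v} \<and> (\<forall>w\<in>span {v}. orthogonal (g - p) w))"


section \<open>Polygons\<close>

text \<open>A polygon is given by a sequence \<open>A\<close> of which only the terms \<open>A 0, \<dots>, A (n + 1)\<close> matter;
  \<open>A 0 = A n\<close> is the indexing convention giving every vertex \<open>A i\<close> with \<open>i \<in> {1..n}\<close> a predecessor.
  In the last clause, the segments containing \<open>A i\<close> are exactly the one ending and the one starting
  at index \<open>i\<close>; the one ending at index 1 is the segment number \<open>n\<close>.\<close>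

definition is_polygon :: "nat \<Rightarrow> (nat \<Rightarrow> 'a::euclidean_space) \<Rightarrow> bool" where
  "is_polygon n A \<longleftrightarrow>
     3 \<le> n \<and> A (n + 1) = A 1 \<and> A 0 = A n \<and>
     (\<forall>i\<in>{1..n}. \<forall>j\<in>{1..n}. i \<noteq> j \<longrightarrow>
        open_segment (A i) (A (i + 1)) \<inter> open_segment (A j) (A (j + 1)) = {}) \<and>
     (\<forall>i\<in>{1..n}. \<forall>j\<in>{1..n}.
        A i \<in> closed_segment (A j) (A (j + 1)) \<longleftrightarrow> j = i \<or> j + 1 = i \<or> (i = 1 \<and> j = n))"

definition polygon_curve :: "nat \<Rightarrow> (nat \<Rightarrow> 'a::euclidean_space) \<Rightarrow> 'a set" where
  "polygon_curve n A = (\<Union>i\<in>{1..n}. closed_segment (A i) (A (i + 1)))"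

text \<open>At a vertex, which lies on two segments, the tangent direction is taken from the segment of smaller
  index; this concerns finitely many points only, i.e. a null set for \<^const>\<open>hausdorff1\<close>.\<close>

definition tangential_gradient ::
    "nat \<Rightarrow> (nat \<Rightarrow> 'a::euclidean_space) \<Rightarrow> ('a \<Rightarrow> real) \<Rightarrow> 'a \<Rightarrow> 'a" where
  "tangential_gradient n A u x =
     (let i = (LEAST i. i \<in> {1..n} \<and> x \<in> closed_segment (A i) (A (i + 1)))
      in orth_proj_line (A (i + 1) - A i) (gradient u x))"

text \<open>For a polygon, the set of quotients is nonempty and bounded below by 0, and all the integrands
  are bounded, so the real-valued \<^const>\<open>Inf\<close> and integral are the intended ones.\<close>

definition polygon_lambda1 :: "nat \<Rightarrow> (nat \<Rightarrow> 'a::euclidean_space) \<Rightarrow> real" where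
  "polygon_lambda1 n A =
     Inf {(LINT x:polygon_curve n A|hausdorff1. (norm (tangential_gradient n A u x))\<^sup>2) /
            (\<Sum>i=1..n. (u (A i))\<^sup>2)
          | u. smooth_function u \<and> (\<Sum>i=1..n. (u (A i))\<^sup>2) \<noteq> 0 \<and> (\<Sum>i=1..n. u (A i)) = 0}"

definition polygon_mean_curvature :: "(nat \<Rightarrow> 'a::euclidean_space) \<Rightarrow> nat \<Rightarrow> 'a" where
  "polygon_mean_curvature A i =
     (A i - A (i - 1)) /\<^sub>R norm (A i - A (i - 1)) + (A i - A (i + 1)) /\<^sub>R norm (A i - A (i + 1))"

end

theory Submission
  imports Defs
begin

text \<open>
  Let \<open>m\<close> be the centroid of the vertices, \<open>S = \<Sum>i. |A i - m|\<^sup>2\<close> and \<open>L\<close> the total length of the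
  sides. The coordinates of \<open>x - m\<close> are admissible test functions, and the squares of their tangential
  gradients add up to 1 along the curve, so \<open>\<lambda>\<^sub>1 S \<le> \<H>\<^sup>1(K)\<close>. Summation by parts around the polygon
  gives the discrete Minkowski formula \<open>L = \<Sum>i. (A i - m) \<bullet> H i\<close>, whence
  \<open>L\<^sup>2 \<le> S (\<Sum>i. |H i|\<^sup>2)\<close> by Cauchy-Schwarz. Together with \<open>\<H>\<^sup>1(K) \<le> L\<close> (the only fact about the Hausdorff
  measure of a curve that is needed) this yields \<open>\<lambda>\<^sub>1 \<H>\<^sup>1(K) S \<le> L\<^sup>2 \<le> S (\<Sum>i. |H i|\<^sup>2)\<close>.
\<close>

section \<open>Length bounds the Hausdorff measure\<close>

lemma diameter_closed_segment_le:
  fixes a b :: "'a::euclidean_space"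
  shows "diameter (closed_segment a b) \<le> dist a b"
proof (rule diameter_le)
  fix x y assume "x \<in> closed_segment a b" "y \<in> closed_segment a b"
  then obtain s t where st: "0 \<le> s" "s \<le> 1" "0 \<le> t" "t \<le> 1"
    "x = (1 - s) *\<^sub>R a + s *\<^sub>R b" "y = (1 - t) *\<^sub>R a + t *\<^sub>R b"
    by (auto simp: in_segment)
  have "x - y = (s - t) *\<^sub>R (b - a)" unfolding st(5,6) by (simp add: algebra_simps)
  then have "norm (x - y) = \<bar>s - t\<bar> * dist a b"
    by (simp add: dist_norm norm_minus_commute)
  also have "\<dots> \<le> 1 * dist a b"
    using st by (intro mult_right_mono) auto
  finally show "norm (x - y) \<le> dist a b" by simp
qed auto

text \<open>Cut into equal pieces shorter than \<open>\<delta>\<close>, the segment has a cover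
  whose diameters add up to at most its length. This bounds the content for every
  \<open>\<delta>\<close>, hence the supremum.\<close>

lemma hausdorff1_outer_closed_segment_le:
  fixes a b :: "'a::euclidean_space"
  shows "hausdorff1_outer (closed_segment a b) \<le> ennreal (dist a b)"
  unfolding hausdorff1_outer_def
proof (rule SUP_least)
  fix \<delta> :: real assume "\<delta> \<in> {0<..}"
  then have \<delta>: "\<delta> > 0" by simp
  obtain m0 :: nat where m0: "dist a b / \<delta> < real m0" using reals_Archimedean2 by blast
  define m where "m = Suc m0"
  have m: "m > 0" "dist a b / m \<le> \<delta>"
    using m0 \<delta> by (auto simp: m_def field_simps)
  define p where "p i = a + (real i / m) *\<^sub>R (b - a)" for i :: nat
  \<comment> \<open>The definition of content asks for an infinite sequence; empty sets, of diameter
    0, pad the finite cover.\<close>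
  define C where "C i = (if i < m then closed_segment (p i) (p (Suc i)) else {})" for i
  have "p i - p (Suc i) = - (1 / m) *\<^sub>R (b - a)" for i
    by (simp add: p_def add_divide_distrib algebra_simps)
  then have dist_p: "dist (p i) (p (Suc i)) = dist a b / m" for i
    by (simp add: dist_norm norm_minus_commute)
  have diam: "diameter (C i) \<le> dist a b / m" for i
    using diameter_closed_segment_le[of "p i" "p (Suc i)"] by (simp add: C_def dist_p)
  have cover: "closed_segment a b \<subseteq> (\<Union>i. C i)"
  proof
    fix x assume "x \<in> closed_segment a b"
    then obtain t where t: "0 \<le> t" "t \<le> 1" and x: "x = (1 - t) *\<^sub>R a + t *\<^sub>R b"
      by (auto simp: in_segment)
    \<comment> \<open>The minimum matters only at \<open>t = 1\<close>, where the floor is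
      \<open>m\<close>, one past the last piece.\<close>
    define i where "i = min (nat \<lfloor>t * m\<rfloor>) (m - 1)"
    have "real i \<le> t * m" "t * m \<le> real (Suc i)" "i < m"
    proof -
      have f: "real (nat \<lfloor>t * m\<rfloor>) \<le> t * m" "t * m \<le> real (nat \<lfloor>t * m\<rfloor>) + 1"
        using t by (auto simp: of_nat_nat intro: less_imp_le)
      show "i < m" using m by (auto simp: i_def)
      show "real i \<le> t * m" using f(1) by (simp add: i_def min_def)
      have "t * m \<le> m" using t m mult_right_mono[of t 1 "real m"] by simp
      then show "t * m \<le> real (Suc i)" using f(2) m by (auto simp: i_def min_def of_nat_diff)
    qed
    \<comment> \<open>\<open>s\<close> is the position of \<open>x\<close> within piece number
      \<open>i\<close>, rescaled to the unit interval.\<close>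
    define s where "s = t * m - i"
    have s: "0 \<le> s" "s \<le> 1"
      using \<open>real i \<le> t * m\<close> \<open>t * m \<le> real (Suc i)\<close> by (auto simp: s_def)
    have "(1 - s) *\<^sub>R p i + s *\<^sub>R p (Suc i)
        = a + ((1 - s) * (i / m) + s * (Suc i / m)) *\<^sub>R (b - a)"
      unfolding p_def by (simp add: algebra_simps)
    also have "(1 - s) * (i / m) + s * (Suc i / m) = (s + i) / m"
      using m by (simp add: field_simps)
    also have "(s + i) / m = t" using m by (simp add: s_def)
    also have "a + t *\<^sub>R (b - a) = x" by (simp add: x algebra_simps)
    finally have "x \<in> C i"
      using s \<open>i < m\<close> by (auto simp: C_def in_segment intro!: exI[of _ s])
    then show "x \<in> (\<Union>i. C i)" by blast
  qed
  have small: "bounded (C i) \<and> diameter (C i) \<le> \<delta>" for i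
    using diam[of i] m \<delta> by (auto simp: C_def bounded_closed_segment split: if_splits)
  have "hausdorff1_content \<delta> (closed_segment a b) \<le> (\<Sum>i. ennreal (diameter (C i)))"
    unfolding hausdorff1_content_def by (rule INF_lower) (use cover small in auto)
  also have "\<dots> = (\<Sum>i<m. ennreal (diameter (C i)))"
    by (rule suminf_finite) (auto simp: C_def)
  also have "\<dots> \<le> (\<Sum>i<m. ennreal (dist a b / m))"
    by (intro sum_mono ennreal_leI diam)
  also have "\<dots> = ennreal (\<Sum>i<m. dist a b / m)"
    by (rule sum_ennreal) simp
  also have "\<dots> = ennreal (dist a b)"
    using m by simp
  finally show "hausdorff1_content \<delta> (closed_segment a b) \<le> ennreal (dist a b)" .
qed

lemma sets_hausdorff1: "sets hausdorff1 = sets borel"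
  unfolding hausdorff1_def using sets.sigma_sets_eq[of borel] by (simp add: sets_measure_of_conv)

lemma space_hausdorff1: "space hausdorff1 = UNIV"
  using sets_eq_imp_space_eq[OF sets_hausdorff1] by simp

text \<open>Equality on Borel sets is Caratheodory's theorem, but the inequality is built into
  \<^const>\<open>measure_of\<close>, whose junk value is the zero measure.\<close>

lemma emeasure_hausdorff1_le: "emeasure hausdorff1 X \<le> hausdorff1_outer X"
  unfolding hausdorff1_def by (simp add: emeasure_measure_of_conv)

text \<open>Finite subadditivity over the sides reduces this to single segments; points shared by
  several sides are harmless in an upper bound.\<close>

lemma emeasure_polygon_curve_le:
  "emeasure hausdorff1 (polygon_curve n A) \<le> ennreal (\<Sum>i=1..n. dist (A i) (A (i + 1)))"
proof -
  have "emeasure hausdorff1 (polygon_curve n A)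
      \<le> (\<Sum>i=1..n. emeasure hausdorff1 (closed_segment (A i) (A (i + 1))))"
    unfolding polygon_curve_def
    by (rule emeasure_subadditive_finite) (auto simp: sets_hausdorff1)
  also have "\<dots> \<le> (\<Sum>i=1..n. ennreal (dist (A i) (A (i + 1))))"
    by (intro sum_mono order_trans[OF emeasure_hausdorff1_le hausdorff1_outer_closed_segment_le])
  finally show ?thesis by simp
qed

lemma measure_polygon_curve_le:
  "measure hausdorff1 (polygon_curve n A) \<le> (\<Sum>i=1..n. dist (A i) (A (i + 1)))"
  using enn2real_mono[OF emeasure_polygon_curve_le[of n A]]
  by (simp add: measure_def sum_nonneg)

lemma sets_polygon_curve: "polygon_curve n A \<in> sets hausdorff1"
  unfolding polygon_curve_def sets_hausdorff1 by (intro sets.finite_UN) auto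

section \<open>Affine test functions\<close>

lemma Ck_function_const: "Ck_function k (\<lambda>x. c)"
  by (induction k arbitrary: c) auto

lemma has_derivative_inner_diff:
  "((\<lambda>x. inner x e - c) has_derivative (\<lambda>h. inner h e)) (at x)"
  by (auto intro!: derivative_eq_intros)

lemma smooth_function_inner_diff: "smooth_function (\<lambda>x. inner x e - c)"
  unfolding smooth_function_def
proof
  fix k show "Ck_function k (\<lambda>x. inner x e - c)"
  proof (cases k)
    case 0
    then show ?thesis by (auto intro!: continuous_intros)
  next
    case (Suc j)
    \<comment> \<open>The derivative does not depend on \<open>x\<close>, so every directional
      derivative is a constant function and all higher orders reduce to
      \<open>Ck_function_const\<close>.\<close>
    have "frechet_derivative (\<lambda>x. inner x e - c) (at x) = (\<lambda>h. inner h e)" for x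
      by (rule frechet_derivative_at[symmetric]) (rule has_derivative_inner_diff)
    then show ?thesis
      using has_derivative_inner_diff by (auto simp: Suc Ck_function_const intro: differentiableI)
  qed
qed

lemma gradient_inner_diff: "gradient (\<lambda>x. inner x e - c) x = e"
  unfolding gradient_def
proof (rule the_equality)
  show "GDERIV (\<lambda>x. inner x e - c) x :> e"
    unfolding gderiv_def by (rule has_derivative_inner_diff)
  fix D assume "GDERIV (\<lambda>x. inner x e - c) x :> D"
  then have "(\<lambda>h. inner h D) = (\<lambda>h. inner h e)"
    unfolding gderiv_def by (rule has_derivative_unique[OF _ has_derivative_inner_diff])
  \<comment> \<open>Testing the two equal derivatives in the direction \<open>D - e\<close> shows
    that this vector has norm 0.\<close>
  then have "inner (D - e) D = inner (D - e) e"
    by (rule fun_cong)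
  then have "inner (D - e) (D - e) = 0"
    by (simp add: inner_diff_right)
  then show "D = e" by simp
qed

lemma orth_proj_line_eq:
  assumes "v \<noteq> 0"
  shows "orth_proj_line v g = (inner g v / inner v v) *\<^sub>R v"
  unfolding orth_proj_line_def
proof (rule the_equality)
  show "(inner g v / inner v v) *\<^sub>R v \<in> span {v} \<and>
      (\<forall>w\<in>span {v}. orthogonal (g - (inner g v / inner v v) *\<^sub>R v) w)"
    using assms by (auto simp: span_singleton orthogonal_def inner_diff_left)
  fix p assume p: "p \<in> span {v} \<and> (\<forall>w\<in>span {v}. orthogonal (g - p) w)"
  then obtain k where k: "p = k *\<^sub>R v" by (auto simp: span_singleton)
  have "orthogonal (g - p) v" using p by (auto simp: span_base)
  then have "inner g v = k * inner v v" by (simp add: k orthogonal_def inner_diff_left)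
  then show "p = (inner g v / inner v v) *\<^sub>R v" using assms k by simp
qed

lemma norm_orth_proj_line_sq:
  assumes "v \<noteq> 0"
  shows "(norm (orth_proj_line v g))\<^sup>2 = (inner v g)\<^sup>2 / (norm v)\<^sup>2"
  using assms unfolding orth_proj_line_eq[OF assms] power2_norm_eq_inner
  by (simp add: inner_commute power2_eq_square)

lemma sum_Basis_inner_sq: "(\<Sum>b\<in>Basis. (inner x b)\<^sup>2) = (norm x)\<^sup>2"
  unfolding power2_norm_eq_inner euclidean_inner[of x x] by (simp add: power2_eq_square)

section \<open>Polygons\<close>

text \<open>A degenerate side \<open>i\<close> would put \<open>A i\<close> on the following side as
  well (number 1 if \<open>i = n\<close>). As \<open>3 \<le> n\<close>, that side is not one of the
  two allowed at \<open>A i\<close> by the incidence clause.\<close>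

lemma is_polygon_Suc_neq:
  assumes "is_polygon n A" "i \<in> {1..n}"
  shows "A (i + 1) \<noteq> A i"
proof
  assume eq: "A (i + 1) = A i"
  have n: "3 \<le> n" "A (n + 1) = A 1"
    and iff: "\<And>j. j \<in> {1..n} \<Longrightarrow>
      A i \<in> closed_segment (A j) (A (j + 1)) \<longleftrightarrow> j = i \<or> j + 1 = i \<or> (i = 1 \<and> j = n)"
    using assms unfolding is_polygon_def by auto
  show False
  proof (cases "i = n")
    case True
    then show False using iff[of 1] n eq by auto
  next
    case False
    have "A i \<in> closed_segment (A (i + 1)) (A (i + 1 + 1))"
      using eq by simp
    then show False using iff[of "i + 1"] n assms(2) False by auto
  qed
qed

text \<open>Each gradient is a basis vector \<open>b\<close>, and its projection has squared length
  equal to the squared \<open>b\<close>-component of the unit tangent; Parseval's identity sums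
  these to 1. The argument applies at vertices too, so no null set has to be removed.\<close>

lemma sum_tangential_gradient_sq:
  fixes A :: "nat \<Rightarrow> 'a::euclidean_space"
  assumes "is_polygon n A" "x \<in> polygon_curve n A"
  shows "(\<Sum>b\<in>Basis. (norm (tangential_gradient n A (\<lambda>y. inner y b - c b) x))\<^sup>2) = 1"
proof -
  define i where "i = (LEAST i. i \<in> {1..n} \<and> x \<in> closed_segment (A i) (A (i + 1)))"
  have "\<exists>i. i \<in> {1..n} \<and> x \<in> closed_segment (A i) (A (i + 1))"
    using assms(2) unfolding polygon_curve_def by blast
  then have "i \<in> {1..n}" unfolding i_def by (rule LeastI2_ex) blast
  then have v: "A (i + 1) - A i \<noteq> 0" using is_polygon_Suc_neq[OF assms(1)] by simp
  have "(\<Sum>b\<in>Basis. (norm (tangential_gradient n A (\<lambda>y. inner y b - c b) x))\<^sup>2)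
      = (\<Sum>b\<in>Basis. (inner (A (i + 1) - A i) b)\<^sup>2 / (norm (A (i + 1) - A i))\<^sup>2)"
    unfolding tangential_gradient_def Let_def i_def[symmetric] gradient_inner_diff
      norm_orth_proj_line_sq[OF v] ..
  also have "\<dots> = 1"
    using v by (simp flip: sum_divide_distrib add: sum_Basis_inner_sq del: right_minus_eq)
  finally show ?thesis .
qed

section \<open>The variational bound for the first eigenvalue\<close>

lemma polygon_lambda1_mult_le:
  assumes "smooth_function u" "(\<Sum>i=1..n. u (A i)) = 0"
  shows "polygon_lambda1 n A * (\<Sum>i=1..n. (u (A i))\<^sup>2)
    \<le> (LINT x:polygon_curve n A|hausdorff1. (norm (tangential_gradient n A u x))\<^sup>2)"
proof (cases "(\<Sum>i=1..n. (u (A i))\<^sup>2) = 0")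
  \<comment> \<open>Functions vanishing at all vertices are excluded from the infimum. A coordinate
    function does so when the polygon lies in a hyperplane parallel to the coordinate axes, so the
    product form has to cover this case.\<close>
  case True
  then show ?thesis
    by (simp add: set_lebesgue_integral_def integral_nonneg_AE)
next
  case False
  have "polygon_lambda1 n A
      \<le> (LINT x:polygon_curve n A|hausdorff1. (norm (tangential_gradient n A u x))\<^sup>2)
        / (\<Sum>i=1..n. (u (A i))\<^sup>2)"
    unfolding polygon_lambda1_def
  proof (rule cInf_lower)
    show "bdd_below {(LINT x:polygon_curve n A|hausdorff1. (norm (tangential_gradient n A u x))\<^sup>2) /
            (\<Sum>i=1..n. (u (A i))\<^sup>2)
          | u. smooth_function u \<and> (\<Sum>i=1..n. (u (A i))\<^sup>2) \<noteq> 0 \<and> (\<Sum>i=1..n. u (A i)) = 0}"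
      by (rule bdd_belowI[of _ 0])
        (auto simp: set_lebesgue_integral_def intro!: divide_nonneg_nonneg sum_nonneg integral_nonneg_AE)
  qed (use assms False in blast)
  moreover have "(\<Sum>i=1..n. (u (A i))\<^sup>2) > 0"
    using False by (simp add: less_le sum_nonneg)
  ultimately show ?thesis by (simp add: pos_le_divide_eq)
qed

text \<open>Nonintegrable summands only help: their integral is 0 by convention.\<close>

lemma sum_integral_le:
  fixes f :: "'i \<Rightarrow> 'b \<Rightarrow> real"
  assumes "finite I" "integrable M g"
    and nonneg: "\<And>i x. i \<in> I \<Longrightarrow> 0 \<le> f i x"
    and le: "\<And>x. (\<Sum>i\<in>I. f i x) \<le> g x"
  shows "(\<Sum>i\<in>I. integral\<^sup>L M (f i)) \<le> integral\<^sup>L M g"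
proof -
  define J where "J = {i\<in>I. integrable M (f i)}"
  have "(\<Sum>i\<in>I. integral\<^sup>L M (f i)) = (\<Sum>i\<in>J. integral\<^sup>L M (f i))"
    using \<open>finite I\<close> by (intro sum.mono_neutral_right) (auto simp: J_def not_integrable_integral_eq)
  also have "\<dots> = (\<integral>x. (\<Sum>i\<in>J. f i x) \<partial>M)"
    by (rule Bochner_Integration.integral_sum[symmetric]) (simp add: J_def)
  also have "\<dots> \<le> integral\<^sup>L M g"
  proof (rule integral_mono)
    fix x
    have "(\<Sum>i\<in>J. f i x) \<le> (\<Sum>i\<in>I. f i x)"
      using \<open>finite I\<close> nonneg by (intro sum_mono2) (auto simp: J_def)
    then show "(\<Sum>i\<in>J. f i x) \<le> g x" using le order_trans by blast
  qed (use assms in \<open>auto simp: J_def\<close>)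
  finally show ?thesis .
qed

lemma polygon_lambda1_variance_le:
  fixes A :: "nat \<Rightarrow> 'a::euclidean_space"
  assumes poly: "is_polygon n A" and m: "(\<Sum>i=1..n. A i - m) = 0"
  shows "polygon_lambda1 n A * (\<Sum>i=1..n. (norm (A i - m))\<^sup>2)
    \<le> measure hausdorff1 (polygon_curve n A)"
proof -
  define K where "K = polygon_curve n A"
  define u where "u b = (\<lambda>x. inner x b - inner m b)" for b :: 'a
  have fin: "emeasure hausdorff1 K < \<infinity>"
    using emeasure_polygon_curve_le[of n A] by (simp add: K_def ennreal_less_top le_less_trans)
  have "(\<Sum>i=1..n. (norm (A i - m))\<^sup>2) = (\<Sum>b\<in>Basis. \<Sum>i=1..n. (u b (A i))\<^sup>2)"
    unfolding sum.swap[of _ _ Basis]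
    by (simp add: u_def flip: sum_Basis_inner_sq inner_diff_left)
  then have "polygon_lambda1 n A * (\<Sum>i=1..n. (norm (A i - m))\<^sup>2)
      = (\<Sum>b\<in>Basis. polygon_lambda1 n A * (\<Sum>i=1..n. (u b (A i))\<^sup>2))"
    by (simp add: sum_distrib_left)
  also have "\<dots> \<le> (\<Sum>b\<in>Basis. LINT x:K|hausdorff1. (norm (tangential_gradient n A (u b) x))\<^sup>2)"
    unfolding K_def
  proof (intro sum_mono polygon_lambda1_mult_le)
    fix b :: 'a
    show "smooth_function (u b)" unfolding u_def by (rule smooth_function_inner_diff)
    \<comment> \<open>The choice of \<open>m\<close> as centroid is what makes the coordinate
      functions satisfy the mean-zero constraint.\<close>
    have "(\<Sum>i=1..n. u b (A i)) = inner (\<Sum>i=1..n. A i - m) b"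
      by (simp add: u_def inner_sum_left inner_diff_left)
    then show "(\<Sum>i=1..n. u b (A i)) = 0" unfolding m by simp
  qed
  also have "\<dots> \<le> (\<integral>x. indicat_real K x \<partial>hausdorff1)"
    unfolding set_lebesgue_integral_def
  proof (rule sum_integral_le)
    show "integrable hausdorff1 (indicat_real K)"
      using fin by (simp add: integrable_indicator_iff K_def sets_polygon_curve space_hausdorff1)
    fix x
    show "(\<Sum>b\<in>Basis. indicat_real K x *\<^sub>R (norm (tangential_gradient n A (u b) x))\<^sup>2) \<le> indicator K x"
      using sum_tangential_gradient_sq[OF poly, of x "inner m"]
      by (auto simp: u_def K_def indicator_def)
  qed auto
  also have "\<dots> = measure hausdorff1 K" by (simp add: space_hausdorff1)
  finally show ?thesis unfolding K_def .
qed

section \<open>The discrete Minkowski formula\<close>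

lemma polygon_length_eq_sum_inner_curvature:
  fixes A :: "nat \<Rightarrow> 'a::euclidean_space"
  assumes "A (n + 1) = A 1" "A 0 = A n"
  shows "(\<Sum>i=1..n. dist (A i) (A (i + 1)))
    = (\<Sum>i=1..n. inner (A i - m) (polygon_mean_curvature A i))"
proof -
  \<comment> \<open>\<open>t i\<close> is the unit direction of the side ending at
    \<open>A i\<close>, so the curvature vector is a difference of consecutive \<open>t\<close>,
    ready for summation by parts.\<close>
  define t where "t i = (A i - A (i - 1)) /\<^sub>R norm (A i - A (i - 1))" for i
  define g where "g i = inner (A i - m) (t i)" for i
  have H: "polygon_mean_curvature A i = t i - t (i + 1)" for i
    by (simp add: polygon_mean_curvature_def t_def norm_minus_commute algebra_simps)
  \<comment> \<open>The closing conventions for \<open>A\<close> also give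
    \<open>t (n + 1) = t 1\<close>, so the boundary terms cancel.\<close>
  have "g (n + 1) = g 1" using assms by (simp add: g_def t_def)
  then have shift: "(\<Sum>i=1..n. g (i + 1)) = (\<Sum>i=1..n. g i)"
    using sum_Suc_diff[of 1 n g] by (simp add: sum_subtractf)
  have "dist (A i) (A (i + 1)) = inner (A (i + 1) - A i) (t (i + 1))" for i
    by (cases "A i = A (Suc i)")
      (simp_all add: t_def dist_norm norm_minus_commute divide_inverse_commute
        power2_norm_eq_inner[symmetric] power2_eq_square)
  then have "(\<Sum>i=1..n. dist (A i) (A (i + 1)))
      = (\<Sum>i=1..n. g (i + 1) - inner (A i - m) (t (i + 1)))"
    by (simp add: g_def inner_diff_left)
  also have "\<dots> = (\<Sum>i=1..n. g i) - (\<Sum>i=1..n. inner (A i - m) (t (i + 1)))"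
    by (simp only: sum_subtractf shift)
  also have "\<dots> = (\<Sum>i=1..n. inner (A i - m) (polygon_mean_curvature A i))"
    by (simp add: H g_def inner_diff_right sum_subtractf)
  finally show ?thesis .
qed

section \<open>Cauchy-Schwarz and the conclusion\<close>

lemma sum_inner_sq_le:
  fixes f g :: "'i \<Rightarrow> 'a::real_inner"
  shows "(\<Sum>i\<in>I. inner (f i) (g i))\<^sup>2 \<le> (\<Sum>i\<in>I. (norm (f i))\<^sup>2) * (\<Sum>i\<in>I. (norm (g i))\<^sup>2)"
proof -
  have "\<bar>\<Sum>i\<in>I. inner (f i) (g i)\<bar> \<le> (\<Sum>i\<in>I. norm (f i) * norm (g i))"
    by (rule order_trans[OF sum_abs sum_mono]) (rule Cauchy_Schwarz_ineq2)
  then have "(\<Sum>i\<in>I. inner (f i) (g i))\<^sup>2 \<le> (\<Sum>i\<in>I. norm (f i) * norm (g i))\<^sup>2"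
    by (metis abs_ge_zero power2_abs power_mono)
  also have "\<dots> \<le> (\<Sum>i\<in>I. (norm (f i))\<^sup>2) * (\<Sum>i\<in>I. (norm (g i))\<^sup>2)"
    by (rule Cauchy_Schwarz_ineq_sum)
  finally show ?thesis .
qed

theorem theorem1p3:
  fixes A :: "nat \<Rightarrow> real ^ 'N" and n :: nat
  assumes "is_polygon n A"
  shows "measure hausdorff1 (polygon_curve n A) * polygon_lambda1 n A
           \<le> (\<Sum>i=1..n. (norm (polygon_mean_curvature A i))\<^sup>2)"
proof -
  have n: "3 \<le> n" and closed: "A (n + 1) = A 1" "A 0 = A n"
    using assms unfolding is_polygon_def by auto
  define m where "m = (\<Sum>i=1..n. A i) /\<^sub>R real n"
  define S where "S = (\<Sum>i=1..n. (norm (A i - m))\<^sup>2)"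
  define L where "L = (\<Sum>i=1..n. dist (A i) (A (i + 1)))"
  define H where "H = measure hausdorff1 (polygon_curve n A)"
  have H: "0 \<le> H" "H \<le> L"
    using measure_polygon_curve_le[of n A] by (auto simp: H_def L_def)
  have "(\<Sum>i=1..n. A i - m) = 0"
    using n by (simp add: sum_subtractf m_def sum_constant_scaleR del: sum_constant)
  then have "polygon_lambda1 n A * S \<le> H"
    unfolding S_def H_def by (rule polygon_lambda1_variance_le[OF assms])
  then have "H * polygon_lambda1 n A * S \<le> H * H"
    using mult_left_mono[OF _ H(1)] by (simp add: mult.assoc)
  also have "\<dots> \<le> L\<^sup>2"
    using H by (simp add: power2_eq_square mult_mono)
  also have "\<dots> \<le> S * (\<Sum>i=1..n. (norm (polygon_mean_curvature A i))\<^sup>2)"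
    unfolding L_def S_def polygon_length_eq_sum_inner_curvature[of A n m, OF closed]
    by (rule sum_inner_sq_le)
  finally have "H * polygon_lambda1 n A * S
      \<le> (\<Sum>i=1..n. (norm (polygon_mean_curvature A i))\<^sup>2) * S"
    by (simp add: mult.commute)
  \<comment> \<open>Positivity allows cancelling \<open>S\<close>: two consecutive vertices differ,
    so they cannot both be the centroid.\<close>
  moreover have "S > 0"
  proof -
    have "A 1 \<noteq> A 2" using is_polygon_Suc_neq[OF assms, of 1] n by (auto simp: numeral_2_eq_2)
    then have "A 1 \<noteq> m \<or> A 2 \<noteq> m" by auto
    moreover have "1 \<in> {1..n}" "2 \<in> {1..n}" using n by auto
    ultimately obtain i where "i \<in> {1..n}" "A i \<noteq> m" by blast
    then show ?thesis unfolding S_def by (intro sum_pos2[of _ i]) auto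
  qed
  ultimately show ?thesis by (simp add: H_def)
qed

end
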